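(* Let $n\ge 0$ be an integer. A (nonempty) smooth manifold of dimension $4n+1$ does not admit any almost cosymplectic circle, and thus does not admit any almost cosymplectic $p$-sphere for $p\geq 2$.
   Context: An almost cosymplectic structure on a smooth manifold $M$ of dimension $2m+1$ is a pair $(\eta,\Omega)$ consisting of a $1$-form $\eta$ and a $2$-form $\Omega$ such that $\eta\wedge\Omega^m$ is a volume form (nowhere zero). For $p\ge1$, almost cosymplectic structures $(\eta_1,\Omega_1),\ldots,(\eta_{p+1},\Omega_{p+1})$ on $M$ generate an almost cosymplectic $p$-sphere if for every $\lambda=(\lambda_1,\ldots,\lambda_{p+1})\in\mathbb{S}^p$ the pair $(\sum_i\lambda_i\eta_i,\sum_i\lambda_i\Omega_i)$ is an almost cosymplectic structure on $M$. An almost cosymplectic circle is an almost cosymplectic $1$-sphere. *)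

theory Defs
  imports "HOL-Analysis.Analysis" "HOL-Combinatorics.Permutations"
begin

section \<open>Smooth maps on open subsets of Euclidean space\<close>

text \<open>Only meaningful for open \<open>S\<close>.  For \<open>k > 0\<close>, all directional derivatives
  are required to be \<open>k - 1\<close> times continuously differentiable.\<close>

primrec Ck_on :: "nat \<Rightarrow> ('a::real_normed_vector \<Rightarrow> 'b::real_normed_vector) \<Rightarrow> 'a set \<Rightarrow> bool" where
  "Ck_on 0 f S \<longleftrightarrow> continuous_on S f"
| "Ck_on (Suc k) f S \<longleftrightarrow> (\<forall>x\<in>S. f differentiable (at x)) \<and>
     (\<forall>w. Ck_on k (\<lambda>x. frechet_derivative f (at x) w) S)"

definition smooth_map_on :: "('a::real_normed_vector \<Rightarrow> 'b::real_normed_vector) \<Rightarrow> 'a set \<Rightarrow> bool" where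
  "smooth_map_on f S \<longleftrightarrow> (\<forall>k. Ck_on k f S)"


section \<open>Smooth manifolds\<close>

text \<open>A chart is a pair of a domain and a coordinate map; the dimension of the manifold is
  \<open>CARD('d)\<close>.\<close>

type_synonym ('a, 'd) chart = "'a set \<times> ('a \<Rightarrow> real ^ 'd)"

definition is_chart :: "'a topology \<Rightarrow> ('a, 'd::finite) chart \<Rightarrow> bool" where
  "is_chart X c \<longleftrightarrow> openin X (fst c) \<and> open (snd c ` fst c) \<and>
     homeomorphic_map (subtopology X (fst c)) (top_of_set (snd c ` fst c)) (snd c)"

definition chart_inv :: "('a, 'd::finite) chart \<Rightarrow> real ^ 'd \<Rightarrow> 'a" where
  "chart_inv c = inv_into (fst c) (snd c)"

definition transition :: "('a, 'd::finite) chart \<Rightarrow> ('a, 'd) chart \<Rightarrow> real ^ 'd \<Rightarrow> real ^ 'd" where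
  "transition c c' = snd c' \<circ> chart_inv c"

definition smooth_atlas :: "'a topology \<Rightarrow> ('a, 'd::finite) chart set \<Rightarrow> bool" where
  "smooth_atlas X A \<longleftrightarrow> (\<forall>c\<in>A. is_chart X c) \<and> (\<Union>c\<in>A. fst c) = topspace X \<and>
     (\<forall>c\<in>A. \<forall>c'\<in>A. smooth_map_on (transition c c') (snd c ` (fst c \<inter> fst c')))"

text \<open>The smooth structure is the one generated by \<open>A\<close>; maximality of \<open>A\<close> is not required.\<close>

definition smooth_manifold :: "'a topology \<Rightarrow> ('a, 'd::finite) chart set \<Rightarrow> bool" where
  "smooth_manifold X A \<longleftrightarrow> Hausdorff_space X \<and> second_countable X \<and> smooth_atlas X A"


section \<open>Tangent vectors\<close>

text \<open>A tangent vector at \<open>p\<close> is the family of its coordinate vectors in all the charts around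
  \<open>p\<close>, related by the derivatives of the transition maps (and \<open>0\<close> at the other indices).
  The vector space operations are pointwise.\<close>

type_synonym ('a, 'd) tvec = "('a, 'd) chart \<Rightarrow> real ^ 'd"

definition transition_deriv ::
    "('a, 'd::finite) chart \<Rightarrow> ('a, 'd) chart \<Rightarrow> 'a \<Rightarrow> real ^ 'd \<Rightarrow> real ^ 'd" where
  "transition_deriv c c' p = frechet_derivative (transition c c') (at (snd c p))"

definition tangent_space :: "('a, 'd::finite) chart set \<Rightarrow> 'a \<Rightarrow> ('a, 'd) tvec set" where
  "tangent_space A p = {v.
     (\<forall>c\<in>A. \<forall>c'\<in>A. p \<in> fst c \<inter> fst c' \<longrightarrow> v c' = transition_deriv c c' p (v c)) \<and>
     (\<forall>c. \<not> (c \<in> A \<and> p \<in> fst c) \<longrightarrow> v c = 0)}"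

definition tvec_lincomb ::
    "real \<Rightarrow> ('a, 'd::finite) tvec \<Rightarrow> real \<Rightarrow> ('a, 'd) tvec \<Rightarrow> ('a, 'd) tvec" where
  "tvec_lincomb a v b w = (\<lambda>c. a *\<^sub>R v c + b *\<^sub>R w c)"

text \<open>The tangent vector at \<open>p\<close> with coordinates \<open>w\<close> in the chart \<open>c\<close>; for fixed \<open>w\<close> this is
  a coordinate vector field with constant coefficients on the domain of \<open>c\<close>.\<close>

definition coord_tvec ::
    "('a, 'd::finite) chart set \<Rightarrow> ('a, 'd) chart \<Rightarrow> real ^ 'd \<Rightarrow> 'a \<Rightarrow> ('a, 'd) tvec" where
  "coord_tvec A c w p = (\<lambda>c'. if c' \<in> A \<and> p \<in> fst c' then transition_deriv c c' p w else 0)"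


section \<open>Differential forms\<close>

text \<open>The arguments of a \<open>k\<close>-form at a point are given as a list of \<open>k\<close> tangent vectors.
  Values of a form outside the manifold, or on lists that are not of this kind, are irrelevant.\<close>

type_synonym ('a, 'd) dform = "'a \<Rightarrow> ('a, 'd) tvec list \<Rightarrow> real"

definition tangent_lists :: "('a, 'd::finite) chart set \<Rightarrow> nat \<Rightarrow> 'a \<Rightarrow> ('a, 'd) tvec list set" where
  "tangent_lists A k p = {vs. length vs = k \<and> set vs \<subseteq> tangent_space A p}"

definition alternating_at :: "('a, 'd::finite) chart set \<Rightarrow> nat \<Rightarrow> ('a, 'd) dform \<Rightarrow> 'a \<Rightarrow> bool" where
  "alternating_at A k \<omega> p \<longleftrightarrow>
     (\<forall>vs\<in>tangent_lists A k p. \<forall>i<k. \<forall>v\<in>tangent_space A p. \<forall>w\<in>tangent_space A p. \<forall>a b.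
        \<omega> p (vs[i := tvec_lincomb a v b w]) = a * \<omega> p (vs[i := v]) + b * \<omega> p (vs[i := w])) \<and>
     (\<forall>vs\<in>tangent_lists A k p. \<forall>i<k. \<forall>j<k. i \<noteq> j \<and> vs ! i = vs ! j \<longrightarrow> \<omega> p vs = 0)"

text \<open>Smoothness: in every chart, the coefficient functions of the form are smooth.\<close>

definition diff_form ::
    "'a topology \<Rightarrow> ('a, 'd::finite) chart set \<Rightarrow> nat \<Rightarrow> ('a, 'd) dform \<Rightarrow> bool" where
  "diff_form X A k \<omega> \<longleftrightarrow>
     (\<forall>p\<in>topspace X. alternating_at A k \<omega> p) \<and>
     (\<forall>c\<in>A. \<forall>ws. length ws = k \<longrightarrow>
        smooth_map_on (\<lambda>x. \<omega> (chart_inv c x) (map (\<lambda>w. coord_tvec A c w (chart_inv c x)) ws))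
          (snd c ` fst c))"

definition wedge ::
    "nat \<Rightarrow> nat \<Rightarrow> ('a, 'd::finite) dform \<Rightarrow> ('a, 'd) dform \<Rightarrow> ('a, 'd) dform" where
  "wedge k l \<alpha> \<beta> = (\<lambda>p vs.
     (\<Sum>\<sigma> | \<sigma> permutes {..<k + l}. of_int (sign \<sigma>) *
        \<alpha> p (take k (permute_list \<sigma> vs)) * \<beta> p (drop k (permute_list \<sigma> vs))) / (fact k * fact l))"

text \<open>\<open>wedge_power k \<alpha> m\<close> is the \<open>m\<close>-th exterior power of the \<open>k\<close>-form \<open>\<alpha>\<close>, a \<open>k * m\<close>-form;
  the zeroth power is the \<open>0\<close>-form \<open>1\<close>.\<close>

primrec wedge_power :: "nat \<Rightarrow> ('a, 'd::finite) dform \<Rightarrow> nat \<Rightarrow> ('a, 'd) dform" where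
  "wedge_power k \<alpha> 0 = (\<lambda>p vs. 1)"
| "wedge_power k \<alpha> (Suc m) = wedge k (k * m) \<alpha> (wedge_power k \<alpha> m)"

definition nowhere_zero ::
    "'a topology \<Rightarrow> ('a, 'd::finite) chart set \<Rightarrow> nat \<Rightarrow> ('a, 'd) dform \<Rightarrow> bool" where
  "nowhere_zero X A k \<omega> \<longleftrightarrow> (\<forall>p\<in>topspace X. \<exists>vs\<in>tangent_lists A k p. \<omega> p vs \<noteq> 0)"


section \<open>Almost cosymplectic structures, spheres and circles\<close>

text \<open>The product \<open>\<eta> \<and> \<Omega>\<^sup>m\<close> below is automatically a smooth form of top degree \<open>2 * m + 1\<close>,
  so it is a volume form iff it vanishes nowhere.\<close>

definition almost_cosymplectic ::
    "'a topology \<Rightarrow> ('a, 'd::finite) chart set \<Rightarrow> ('a, 'd) dform \<Rightarrow> ('a, 'd) dform \<Rightarrow> bool" where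
  "almost_cosymplectic X A \<eta> \<Omega> \<longleftrightarrow>
     diff_form X A 1 \<eta> \<and> diff_form X A 2 \<Omega> \<and>
     (\<exists>m. CARD('d) = 2 * m + 1 \<and>
        nowhere_zero X A (2 * m + 1) (wedge 1 (2 * m) \<eta> (wedge_power 2 \<Omega> m)))"

definition form_lincomb :: "nat \<Rightarrow> (nat \<Rightarrow> real) \<Rightarrow> (nat \<Rightarrow> ('a, 'd::finite) dform) \<Rightarrow> ('a, 'd) dform" where
  "form_lincomb p l \<omega> = (\<lambda>x vs. \<Sum>i=1..p+1. l i * \<omega> i x vs)"

text \<open>Vectors in \<open>\<real>\<^bsup>p+1\<^esup>\<close> are functions on \<open>nat\<close> vanishing outside \<open>{1..p+1}\<close>.\<close>

definition std_sphere :: "nat \<Rightarrow> (nat \<Rightarrow> real) set" where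
  "std_sphere p = {l. (\<forall>i. i \<notin> {1..p+1} \<longrightarrow> l i = 0) \<and> (\<Sum>i=1..p+1. (l i)\<^sup>2) = 1}"

text \<open>The structures \<open>(\<eta> i, \<Omega> i)\<close> for \<open>i = 1, \<dots>, p + 1\<close> generate an almost cosymplectic
  \<open>p\<close>-sphere.\<close>

definition almost_cosymplectic_sphere ::
    "'a topology \<Rightarrow> ('a, 'd::finite) chart set \<Rightarrow> nat \<Rightarrow>
      (nat \<Rightarrow> ('a, 'd) dform) \<Rightarrow> (nat \<Rightarrow> ('a, 'd) dform) \<Rightarrow> bool" where
  "almost_cosymplectic_sphere X A p \<eta> \<Omega> \<longleftrightarrow> p \<ge> 1 \<and>
     (\<forall>i\<in>{1..p+1}. almost_cosymplectic X A (\<eta> i) (\<Omega> i)) \<and>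
     (\<forall>l\<in>std_sphere p. almost_cosymplectic X A (form_lincomb p l \<eta>) (form_lincomb p l \<Omega>))"

definition almost_cosymplectic_circle ::
    "'a topology \<Rightarrow> ('a, 'd::finite) chart set \<Rightarrow>
      (nat \<Rightarrow> ('a, 'd) dform) \<Rightarrow> (nat \<Rightarrow> ('a, 'd) dform) \<Rightarrow> bool" where
  "almost_cosymplectic_circle X A = almost_cosymplectic_sphere X A 1"

end

theory Submission
  imports Defs
begin

text \<open>Fix a point and tangent vectors \<open>e\<close> on which \<open>\<eta>\<^sub>1 \<and> \<Omega>\<^sub>1\<^bsup>2n\<^esup>\<close> does not vanish.  Since forms of
  top degree at a point form a line, none of the volume forms
  \<open>(\<Sum>\<lambda>\<^sub>i\<eta>\<^sub>i) \<and> (\<Sum>\<lambda>\<^sub>i\<Omega>\<^sub>i)\<^bsup>2n\<^esup>\<close> with \<open>\<lambda>\<close> on the sphere vanishes on \<open>e\<close>.  But its value on \<open>e\<close>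
  is a homogeneous polynomial of odd degree \<open>2n + 1\<close> in \<open>\<lambda>\<close>, so it changes sign on the half
  circle from \<open>\<lambda>\<close> to \<open>-\<lambda>\<close> and has a zero there.\<close>

section \<open>Multilinear antisymmetric functions of top degree\<close>

text \<open>The linear combination \<open>comb\<close> is a parameter so that the notion covers both
  \<open>tvec_lincomb\<close> on tangent vectors and the usual operations on coordinate
  vectors.\<close>

definition multilinear_on ::
    "(real \<Rightarrow> 'v \<Rightarrow> real \<Rightarrow> 'v \<Rightarrow> 'v) \<Rightarrow> 'v set \<Rightarrow> nat \<Rightarrow> ('v list \<Rightarrow> real) \<Rightarrow> bool" where
  "multilinear_on comb T k f \<longleftrightarrow>
     (\<forall>vs i v w a b. length vs = k \<and> set vs \<subseteq> T \<and> i < k \<and> v \<in> T \<and> w \<in> T \<longrightarrow>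
        f (vs[i := comb a v b w]) = a * f (vs[i := v]) + b * f (vs[i := w]))"

text \<open>The sign rule ranges over all lists of length \<open>k\<close>, not only lists of
  tangent vectors: the formula for \<open>wedge\<close> gives it for arbitrary arguments.\<close>

definition antisymmetric_list :: "nat \<Rightarrow> ('v list \<Rightarrow> real) \<Rightarrow> bool" where
  "antisymmetric_list k f \<longleftrightarrow>
     (\<forall>\<tau> vs. \<tau> permutes {..<k} \<and> length vs = k \<longrightarrow> f (permute_list \<tau> vs) = of_int (sign \<tau>) * f vs)"

lemma multilinear_onD:
  assumes "multilinear_on comb T k f" "length vs = k" "set vs \<subseteq> T" "i < k" "v \<in> T" "w \<in> T"
  shows "f (vs[i := comb a v b w]) = a * f (vs[i := v]) + b * f (vs[i := w])"
  using assms unfolding multilinear_on_def by blast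

lemma antisymmetric_list_repeat:
  assumes f: "antisymmetric_list k f" and vs: "length vs = k"
    and ij: "i < k" "j < k" "i \<noteq> j" "vs ! i = vs ! j"
  shows "f vs = 0"
proof -
  let ?t = "Transposition.transpose i j"
  have p: "?t permutes {..<k}" using ij by (intro permutes_swap_id) auto
  have "permute_list ?t vs = vs"
    using p vs ij by (intro nth_equalityI) (auto simp: permute_list_nth Transposition.transpose_def)
  moreover have "f (permute_list ?t vs) = of_int (sign ?t) * f vs"
    using f p vs unfolding antisymmetric_list_def by blast
  moreover have "sign ?t = -1" using ij by (simp add: sign_swap_id)
  ultimately show ?thesis by simp
qed

lemma antisymmetric_list_not_distinct:
  assumes "antisymmetric_list k f" "length vs = k" "\<not> distinct vs"
  shows "f vs = 0"
  using assms antisymmetric_list_repeat unfolding distinct_conv_nth by blast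

text \<open>Makes \<open>span_minimal\<close> applicable in one slot: if f vanishes whenever that
  slot holds a vector of some subset of \<open>W\<close>, it also vanishes for vectors of its
  span.\<close>

lemma subspace_multilinear_zeros:
  fixes W :: "'e::real_vector set"
  assumes f: "multilinear_on (\<lambda>a v b w. a *\<^sub>R v + b *\<^sub>R w) W k f" and W: "subspace W"
    and vs: "length vs = k" "set vs \<subseteq> W" and i: "i < k"
  shows "subspace {v \<in> W. f (vs[i := v]) = 0}"
proof -
  note lin = multilinear_onD[OF f vs i]
  have 0: "f (vs[i := 0]) = 0"
    using lin[of 0 0 0 0] subspace_0[OF W] by simp
  have add: "f (vs[i := v + w]) = f (vs[i := v]) + f (vs[i := w])" if "v \<in> W" "w \<in> W" for v w
    using lin[OF that, of 1 1] by simp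
  have scale: "f (vs[i := c *\<^sub>R v]) = c * f (vs[i := v])" if "v \<in> W" for v c
    using lin[OF that that, of c 0] by simp
  show ?thesis
    unfolding subspace_def using W 0 add scale
    by (auto simp: subspace_0 subspace_add subspace_scale)
qed

text \<open>If an entry \<open>a\<close> of \<open>es\<close> lay in the span of the others, put
  another entry into the slot of \<open>a\<close>: this gives a repetition, so f vanishes. By
  linearity f then vanishes with \<open>a\<close> itself back in its slot.\<close>

lemma alternating_nonzero_independent:
  fixes W :: "'e::real_vector set"
  assumes f: "multilinear_on (\<lambda>a v b w. a *\<^sub>R v + b *\<^sub>R w) W k f" "antisymmetric_list k f"
    and W: "subspace W" and es: "length es = k" "set es \<subseteq> W" "f es \<noteq> 0"
  shows "independent (set es)"
proof
  assume "dependent (set es)"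
  then obtain a where a: "a \<in> set es" "a \<in> span (set es - {a})"
    unfolding dependent_def by blast
  obtain i where i: "i < k" "es ! i = a" using a(1) es(1) by (auto simp: in_set_conv_nth)
  have "set es - {a} \<subseteq> {v \<in> W. f (es[i := v]) = 0}"
  proof safe
    fix b assume b: "b \<in> set es" "b \<noteq> a"
    then show "b \<in> W" using es by auto
    obtain j where j: "j < k" "es ! j = b" using b(1) es(1) by (auto simp: in_set_conv_nth)
    have "i \<noteq> j" using i j b by auto
    then show "f (es[i := b]) = 0"
      using i j es by (intro antisymmetric_list_repeat[OF f(2), of _ i j]) auto
  qed
  then have "span (set es - {a}) \<subseteq> {v \<in> W. f (es[i := v]) = 0}"
    using subspace_multilinear_zeros[OF f(1) W es(1,2) i(1)] by (rule span_minimal)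
  then have "f (es[i := a]) = 0" using a(2) by auto
  then show False using i es by auto
qed

text \<open>By linearity in each slot, f is determined by its values on lists of entries of
  \<open>es\<close>, and by antisymmetry those are all zero once \<open>f es\<close> is.\<close>

lemma alternating_zero_on_span:
  fixes W :: "'e::real_vector set"
  assumes f: "multilinear_on (\<lambda>a v b w. a *\<^sub>R v + b *\<^sub>R w) W k f" "antisymmetric_list k f"
    and W: "subspace W" and es: "length es = k" "set es \<subseteq> W" "W \<subseteq> span (set es)" "f es = 0"
    and vs: "length vs = k" "set vs \<subseteq> W"
  shows "f vs = 0"
proof -
  \<comment> \<open>Slots below \<open>j\<close> hold arbitrary vectors of \<open>W\<close>, those
    from \<open>j\<close> on hold entries of \<open>es\<close>. The induction frees the slots one at
    a time; at \<open>j = k\<close> nothing is constrained.\<close>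
  have "f vs = 0"
    if "length vs = k" "set vs \<subseteq> W" "\<forall>i<k. j \<le> i \<longrightarrow> vs ! i \<in> set es" "j \<le> k" for j vs
    using that
  proof (induction j arbitrary: vs)
    case 0
    \<comment> \<open>Without a repetition, \<open>vs\<close> has k distinct entries taken from the
      at most k entries of \<open>es\<close>, so it is a rearrangement of \<open>es\<close>.\<close>
    show ?case
    proof (cases "distinct vs")
      case True
      have sub: "set vs \<subseteq> set es" using 0 by (auto simp: in_set_conv_nth)
      have "card (set vs) = k" using True 0 by (simp add: distinct_card)
      moreover have "card (set es) \<le> k" using card_length[of es] es(1) by simp
      ultimately have card: "card (set es) = k" "set vs = set es"
        using sub card_mono[of "set es" "set vs"] card_subset_eq[of "set es" "set vs"] by auto
      then have "distinct es" using es(1) by (simp add: card_distinct)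
      then have "mset vs = mset es" using True card(2) set_eq_iff_mset_eq_distinct by blast
      then obtain \<tau> where "\<tau> permutes {..<length es}" "permute_list \<tau> es = vs"
        by (rule mset_eq_permutation)
      then show ?thesis using f(2) es(1,4) unfolding antisymmetric_list_def by fastforce
    next
      case False
      then show ?thesis using antisymmetric_list_not_distinct[OF f(2)] 0 by blast
    qed
  next
    case (Suc j)
    have j: "j < k" using Suc.prems by simp
    \<comment> \<open>With an entry of \<open>es\<close> in slot \<open>j\<close>, only the first
      \<open>j\<close> slots are free, so the induction hypothesis applies.\<close>
    have "set es \<subseteq> {v \<in> W. f (vs[j := v]) = 0}"
    proof safe
      fix b assume b: "b \<in> set es"
      then show bW: "b \<in> W" using es by auto
      have "\<forall>i<k. j \<le> i \<longrightarrow> vs[j := b] ! i \<in> set es"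
        using Suc.prems b by (auto simp: nth_list_update)
      moreover have "set (vs[j := b]) \<subseteq> W"
        using set_update_subset_insert[of vs j b] Suc.prems(2) bW by blast
      ultimately show "f (vs[j := b]) = 0"
        using Suc.prems by (intro Suc.IH) auto
    qed
    then have "span (set es) \<subseteq> {v \<in> W. f (vs[j := v]) = 0}"
      using subspace_multilinear_zeros[OF f(1) W Suc.prems(1,2) j] by (rule span_minimal)
    moreover have "vs ! j \<in> W" using Suc.prems(1,2) j by (auto simp: subset_iff)
    ultimately have "f (vs[j := vs ! j]) = 0" using es(3) by blast
    then show ?case by simp
  qed
  from this[of vs k] show ?thesis using vs by simp
qed

text \<open>Since f is nonzero on \<open>es\<close>, its k entries are independent and hence span
  the k-dimensional space. Were \<open>g es\<close> zero, g would vanish on all lists from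
  \<open>W\<close>, contradicting \<open>vs\<close>.\<close>

lemma alternating_top_degree_nonzero:
  fixes W :: "'e::euclidean_space set"
  assumes k: "k = DIM('e)"
    and f: "multilinear_on (\<lambda>a v b w. a *\<^sub>R v + b *\<^sub>R w) W k f"
      "antisymmetric_list k f"
    and g: "multilinear_on (\<lambda>a v b w. a *\<^sub>R v + b *\<^sub>R w) W k g"
      "antisymmetric_list k g"
    and W: "subspace W"
    and es: "length es = k" "set es \<subseteq> W" "f es \<noteq> 0"
    and vs: "length vs = k" "set vs \<subseteq> W" "g vs \<noteq> 0"
  shows "g es \<noteq> 0"
proof -
  have ind: "independent (set es)"
    using alternating_nonzero_independent[OF f W es] .
  have "distinct es" using antisymmetric_list_not_distinct[OF f(2)] es by blast
  then have "card (set es) = k" using es by (simp add: distinct_card)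
  then have "W \<subseteq> span (set es)"
    using card_ge_dim_independent[of "set es" UNIV] ind k by auto
  then show ?thesis
    using alternating_zero_on_span[OF g W es(1,2)] vs by blast
qed

section \<open>Wedge products: multilinearity, antisymmetry, continuity, homogeneity\<close>

text \<open>Position \<open>j\<close> of the permuted list reads entry \<open>\<sigma> j\<close>, so
  a change at \<open>i\<close> shows up at \<open>inv \<sigma> i\<close>.\<close>

lemma permute_list_update:
  assumes "\<sigma> permutes {..<length vs}" "i < length vs"
  shows "permute_list \<sigma> (vs[i := v]) = (permute_list \<sigma> vs)[inv \<sigma> i := v]"
proof (rule nth_equalityI)
  fix j assume "j < length (permute_list \<sigma> (vs[i := v]))"
  then have j: "j < length vs" by simp
  have "\<sigma> j < length vs" using permutes_in_image[OF assms(1), of j] j by simp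
  moreover have "i = \<sigma> j \<longleftrightarrow> inv \<sigma> i = j" using permutes_inv_eq[OF assms(1), of i j] by auto
  ultimately show "permute_list \<sigma> (vs[i := v]) ! j = (permute_list \<sigma> vs)[inv \<sigma> i := v] ! j"
    using assms j by (auto simp: permute_list_nth nth_list_update)
qed simp

text \<open>In the summand of each permutation the altered entry lands in the arguments of exactly
  one factor, which is linear there, while the other factor stays constant.\<close>

lemma multilinear_on_wedge:
  assumes \<alpha>: "multilinear_on comb T k (\<alpha> p)" and \<beta>: "multilinear_on comb T l (\<beta> p)"
  shows "multilinear_on comb T (k + l) (wedge k l \<alpha> \<beta> p)"
  unfolding multilinear_on_def
proof safe
  fix vs i v w a b
  assume vs: "length vs = k + l" "set vs \<subseteq> T" and i: "i < k + l" and vw: "v \<in> T" "w \<in> T"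
  define t where "t \<sigma> us = of_int (sign \<sigma>) * \<alpha> p (take k (permute_list \<sigma> us)) *
    \<beta> p (drop k (permute_list \<sigma> us))" for \<sigma> us
  have t: "t \<sigma> (vs[i := comb a v b w]) = a * t \<sigma> (vs[i := v]) + b * t \<sigma> (vs[i := w])"
    if \<sigma>: "\<sigma> permutes {..<k + l}" for \<sigma>
  proof -
    define us where "us = permute_list \<sigma> vs"
    define j where "j = inv \<sigma> i"
    have upd: "permute_list \<sigma> (vs[i := x]) = us[j := x]" for x
      unfolding us_def j_def using \<sigma> vs i by (intro permute_list_update) auto
    have us: "length us = k + l" "set us \<subseteq> T"
      using \<sigma> vs unfolding us_def by auto
    then have sub: "set (take k us) \<subseteq> T" "set (drop k us) \<subseteq> T"
      by (meson order_trans set_take_subset set_drop_subset)+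
    have j: "j < k + l"
      unfolding j_def using permutes_in_image[OF permutes_inv[OF \<sigma>], of i] i by simp
    show ?thesis
    proof (cases "j < k")
      case True
      then have "\<alpha> p ((take k us)[j := comb a v b w]) =
          a * \<alpha> p ((take k us)[j := v]) + b * \<alpha> p ((take k us)[j := w])"
        using us sub vw by (intro multilinear_onD[OF \<alpha>]) auto
      then show ?thesis
        using True unfolding t_def upd by (simp add: take_update_swap algebra_simps)
    next
      case False
      then have "\<beta> p ((drop k us)[j - k := comb a v b w]) =
          a * \<beta> p ((drop k us)[j - k := v]) + b * \<beta> p ((drop k us)[j - k := w])"
        using us sub vw j by (intro multilinear_onD[OF \<beta>]) auto
      then show ?thesis
        using False unfolding t_def upd by (simp add: drop_update_swap algebra_simps)
    qed
  qed
  have w: "wedge k l \<alpha> \<beta> p us = (\<Sum>\<sigma> | \<sigma> permutes {..<k + l}. t \<sigma> us) / (fact k * fact l)" for us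
    unfolding wedge_def t_def ..
  have "(\<Sum>\<sigma> | \<sigma> permutes {..<k + l}. t \<sigma> (vs[i := comb a v b w])) =
      a * (\<Sum>\<sigma> | \<sigma> permutes {..<k + l}. t \<sigma> (vs[i := v])) +
      b * (\<Sum>\<sigma> | \<sigma> permutes {..<k + l}. t \<sigma> (vs[i := w]))"
    unfolding sum_distrib_left sum.distrib[symmetric] by (rule sum.cong) (auto simp: t)
  then show "wedge k l \<alpha> \<beta> p (vs[i := comb a v b w]) =
      a * wedge k l \<alpha> \<beta> p (vs[i := v]) + b * wedge k l \<alpha> \<beta> p (vs[i := w])"
    unfolding w by (simp add: add_divide_distrib)
qed

lemma multilinear_on_wedge_power:
  assumes "multilinear_on comb T k (\<alpha> p)"
  shows "multilinear_on comb T (k * m) (wedge_power k \<alpha> m p)"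
proof (induction m)
  case 0
  show ?case by (simp add: multilinear_on_def)
next
  case (Suc m)
  then show ?case using multilinear_on_wedge[of comb T k \<alpha> p "k * m" "wedge_power k \<alpha> m"] assms by simp
qed

text \<open>The sum over all permutations antisymmetrizes any product: reindexing by \<sigma> to
  \<open>\<tau> \<circ> \<sigma>\<close> absorbs \<tau> at the cost of its sign.\<close>

lemma antisymmetric_list_wedge: "antisymmetric_list (k + l) (wedge k l \<alpha> \<beta> p)"
  unfolding antisymmetric_list_def
proof safe
  fix \<tau> and vs :: "('a, 'b) tvec list"
  assume \<tau>: "\<tau> permutes {..<k + l}" and vs: "length vs = k + l"
  define g where "g us = \<alpha> p (take k us) * \<beta> p (drop k us)" for us
  define S where "S = {\<sigma>. \<sigma> permutes {..<k + l}}"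
  have w: "wedge k l \<alpha> \<beta> p us =
      (\<Sum>\<sigma>\<in>S. of_int (sign \<sigma>) * g (permute_list \<sigma> us)) / (fact k * fact l)" for us
    unfolding wedge_def g_def S_def by (simp add: mult.assoc)
  have "(\<Sum>\<sigma>\<in>S. of_int (sign \<sigma>) * g (permute_list \<sigma> vs)) =
      (\<Sum>\<sigma>\<in>S. of_int (sign (\<tau> \<circ> \<sigma>)) * g (permute_list (\<tau> \<circ> \<sigma>) vs))"
    unfolding S_def by (rule setum_permutations_compose_left[OF \<tau>])
  also have "\<dots> = (\<Sum>\<sigma>\<in>S. of_int (sign \<tau>) * (of_int (sign \<sigma>) * g (permute_list \<sigma> (permute_list \<tau> vs))))"
  proof (rule sum.cong[OF refl])
    fix \<sigma> assume "\<sigma> \<in> S"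
    then have \<sigma>: "\<sigma> permutes {..<k + l}" unfolding S_def by simp
    have "sign (\<tau> \<circ> \<sigma>) = sign \<tau> * sign \<sigma>"
      using \<sigma> \<tau> by (intro sign_compose) (auto simp: permutation_permutes)
    moreover have "permute_list (\<tau> \<circ> \<sigma>) vs = permute_list \<sigma> (permute_list \<tau> vs)"
      using \<sigma> vs by (intro permute_list_compose) auto
    ultimately show "of_int (sign (\<tau> \<circ> \<sigma>)) * g (permute_list (\<tau> \<circ> \<sigma>) vs) =
        of_int (sign \<tau>) * (of_int (sign \<sigma>) * g (permute_list \<sigma> (permute_list \<tau> vs)))"
      by simp
  qed
  finally have "(\<Sum>\<sigma>\<in>S. of_int (sign \<sigma>) * g (permute_list \<sigma> vs)) =
      of_int (sign \<tau>) * (\<Sum>\<sigma>\<in>S. of_int (sign \<sigma>) * g (permute_list \<sigma> (permute_list \<tau> vs)))"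
    by (simp add: sum_distrib_left)
  \<comment> \<open>The reindexed identity has the sign on the side of the permuted list;
    multiplying by it once more moves it across.\<close>
  moreover have "of_int (sign \<tau>) * of_int (sign \<tau>) = (1::real)"
    by (simp add: sign_def)
  ultimately show "wedge k l \<alpha> \<beta> p (permute_list \<tau> vs) = of_int (sign \<tau>) * wedge k l \<alpha> \<beta> p vs"
    unfolding w by (simp add: mult.assoc[symmetric])
qed

text \<open>The forms vary with a parameter t while point and arguments stay fixed; the value is a
  finite sum of products of values of the factors.\<close>

lemma continuous_on_wedge:
  assumes "\<And>vs. continuous_on U (\<lambda>t. \<alpha> t p vs)" "\<And>vs. continuous_on U (\<lambda>t. \<beta> t p vs)"
  shows "continuous_on U (\<lambda>t. wedge k l (\<alpha> t) (\<beta> t) p vs)"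
  unfolding wedge_def by (intro continuous_intros assms) auto

lemma continuous_on_wedge_power:
  assumes "\<And>vs. continuous_on U (\<lambda>t. \<alpha> t p vs)"
  shows "continuous_on U (\<lambda>t. wedge_power k (\<alpha> t) m p vs)"
proof (induction m arbitrary: vs)
  case 0
  show ?case by simp
next
  case (Suc m)
  show ?case using continuous_on_wedge[of U \<alpha> p "\<lambda>t. wedge_power k (\<alpha> t) m"] assms Suc.IH by simp
qed

lemma wedge_scale:
  "wedge k l (\<lambda>p vs. a * \<alpha> p vs) (\<lambda>p vs. b * \<beta> p vs) = (\<lambda>p vs. a * b * wedge k l \<alpha> \<beta> p vs)"
  unfolding wedge_def by (simp add: sum_distrib_left algebra_simps)

text \<open>Homogeneity of degree \<open>m\<close>; with one further 1-form factor it decides how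
  the volume form reacts to a change of sign.\<close>

lemma wedge_power_scale:
  "wedge_power k (\<lambda>p vs. a * \<alpha> p vs) m = (\<lambda>p vs. a ^ m * wedge_power k \<alpha> m p vs)"
  by (induction m) (simp_all add: wedge_scale)

section \<open>Tangent spaces and their coordinates in one chart\<close>

lemma linear_transition_deriv:
  assumes "smooth_atlas X A" "c \<in> A" "c' \<in> A" "p \<in> fst c \<inter> fst c'"
  shows "linear (transition_deriv c c' p)"
proof -
  have "Ck_on (Suc 0) (transition c c') (snd c ` (fst c \<inter> fst c'))"
    using assms unfolding smooth_atlas_def smooth_map_on_def by blast
  then have "transition c c' differentiable (at (snd c p))"
    using assms(4) by auto
  then show ?thesis
    unfolding transition_deriv_def by (rule linear_frechet_derivative)
qed

lemma tangent_space_lincomb: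
  assumes "smooth_atlas X A" "v \<in> tangent_space A p" "w \<in> tangent_space A p"
  shows "tvec_lincomb a v b w \<in> tangent_space A p"
proof -
  have tr: "u c' = transition_deriv c c' p (u c)"
    if "u \<in> tangent_space A p" "c \<in> A" "c' \<in> A" "p \<in> fst c \<inter> fst c'" for u c c'
    using that unfolding tangent_space_def by blast
  have out: "u c = 0" if "u \<in> tangent_space A p" "\<not> (c \<in> A \<and> p \<in> fst c)" for u c
    using that unfolding tangent_space_def by blast
  have "tvec_lincomb a v b w c' = transition_deriv c c' p (tvec_lincomb a v b w c)"
    if c: "c \<in> A" "c' \<in> A" "p \<in> fst c \<inter> fst c'" for c c'
    unfolding tvec_lincomb_def tr[OF assms(2) c] tr[OF assms(3) c]
    by (simp add: linear_add linear_scale linear_transition_deriv[OF assms(1) c])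
  moreover have "tvec_lincomb a v b w c = 0" if "\<not> (c \<in> A \<and> p \<in> fst c)" for c
    unfolding tvec_lincomb_def out[OF assms(2) that] out[OF assms(3) that] by simp
  ultimately show ?thesis unfolding tangent_space_def by blast
qed

lemma zero_tangent_space:
  assumes "smooth_atlas X A"
  shows "(\<lambda>_. 0) \<in> tangent_space A p"
  using linear_transition_deriv[OF assms] by (auto simp: tangent_space_def linear_0)

text \<open>The component in one chart around \<open>p\<close> determines those in all others
  through the transition derivatives, and the remaining components are zero.\<close>

lemma inj_on_tangent_space:
  assumes "c \<in> A" "p \<in> fst c"
  shows "inj_on (\<lambda>v. v c) (tangent_space A p)"
proof (rule inj_onI, rule ext)
  fix v w c'
  assume vw: "v \<in> tangent_space A p" "w \<in> tangent_space A p" "v c = w c"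
  show "v c' = w c'"
  proof (cases "c' \<in> A \<and> p \<in> fst c'")
    case True
    then have "v c' = transition_deriv c c' p (v c)" "w c' = transition_deriv c c' p (w c)"
      using vw assms unfolding tangent_space_def by blast+
    then show ?thesis using vw(3) by simp
  next
    case False
    then have "v c' = 0" "w c' = 0" using vw(1,2) unfolding tangent_space_def by blast+
    then show ?thesis by simp
  qed
qed

text \<open>Coordinates in a chart around \<open>p\<close> identify the tangent space with a
  subspace of \<open>real ^ 'd\<close>, where the top-degree result applies. Injectivity of the
  coordinates suffices, because that result allows any subspace.\<close>

lemma tangent_top_degree_nonzero:
  fixes A :: "('a, 'd::finite) chart set"
  assumes X: "smooth_atlas X A" and p: "p \<in> topspace X"
    and f: "multilinear_on tvec_lincomb (tangent_space A p) CARD('d) f"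
      "antisymmetric_list CARD('d) f"
    and g: "multilinear_on tvec_lincomb (tangent_space A p) CARD('d) g"
      "antisymmetric_list CARD('d) g"
    and es: "es \<in> tangent_lists A CARD('d) p" "f es \<noteq> 0"
    and vs: "vs \<in> tangent_lists A CARD('d) p" "g vs \<noteq> 0"
  shows "g es \<noteq> 0"
proof -
  obtain c where c: "c \<in> A" "p \<in> fst c" using X p unfolding smooth_atlas_def by blast
  define T where "T = tangent_space A p"
  define \<phi> :: "('a, 'd) tvec \<Rightarrow> real ^ 'd" where "\<phi> v = v c" for v
  define W where "W = \<phi> ` T"
  define L where "L = inv_into T \<phi>"
  have inj: "inj_on \<phi> T" using inj_on_tangent_space[OF c] unfolding \<phi>_def T_def .
  have L\<phi>: "L (\<phi> v) = v" if "v \<in> T" for v using inj that unfolding L_def by (rule inv_into_f_f)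
  have comb: "tvec_lincomb a v b w \<in> T" if "v \<in> T" "w \<in> T" for a v b w
    using tangent_space_lincomb[OF X] that unfolding T_def by blast
  have \<phi>: "\<phi> (tvec_lincomb a v b w) = a *\<^sub>R \<phi> v + b *\<^sub>R \<phi> w" for a v b w
    unfolding \<phi>_def tvec_lincomb_def ..
  have LW: "L w \<in> T" if "w \<in> W" for w using that L\<phi> unfolding W_def by auto
  have Lcomb: "L (a *\<^sub>R v + b *\<^sub>R w) = tvec_lincomb a (L v) b (L w)" if "v \<in> W" "w \<in> W" for a v b w
    using that comb L\<phi> unfolding W_def by (auto simp flip: \<phi>)
  have W: "subspace W"
  proof (rule subspaceI)
    show "0 \<in> W" using zero_tangent_space[OF X] unfolding W_def T_def \<phi>_def by force
  next
    fix x y assume "x \<in> W" "y \<in> W"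
    then obtain v w where "v \<in> T" "w \<in> T" "x = \<phi> v" "y = \<phi> w" unfolding W_def by auto
    then show "x + y \<in> W" using \<phi>[of 1 v 1 w] comb[of v w 1 1] unfolding W_def by (metis imageI scaleR_one)
  next
    fix a x assume "x \<in> W"
    then obtain v where "v \<in> T" "x = \<phi> v" unfolding W_def by auto
    then show "a *\<^sub>R x \<in> W" using \<phi>[of a v 0 v] comb[of v v a 0] unfolding W_def
      by (metis add.right_neutral imageI scaleR_zero_left)
  qed
  \<comment> \<open>f and g are carried over to coordinate vectors by composing with the inverse
    \<open>L\<close> of the coordinate map.\<close>
  have lin: "multilinear_on (\<lambda>a v b w. a *\<^sub>R v + b *\<^sub>R w) W k (\<lambda>ws. h (map L ws))"
    if h: "multilinear_on tvec_lincomb T k h" for h k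
    unfolding multilinear_on_def
  proof (intro allI impI, elim conjE)
    fix us i v w a b
    assume "length us = k" "set us \<subseteq> W" "i < k" and vw: "v \<in> W" "w \<in> W"
    then show "h (map L (us[i := a *\<^sub>R v + b *\<^sub>R w])) =
        a * h (map L (us[i := v])) + b * h (map L (us[i := w]))"
      unfolding map_update Lcomb[OF vw] using LW by (intro multilinear_onD[OF h]) auto
  qed
  have anti: "antisymmetric_list k (\<lambda>ws. h (map L ws))" if "antisymmetric_list k h" for h k
    using that unfolding antisymmetric_list_def by (auto simp flip: permute_list_map)
  have L_map: "map L (map \<phi> us) = us" if "us \<in> tangent_lists A CARD('d) p" for us
    using that L\<phi> unfolding tangent_lists_def T_def by (auto intro!: map_idI)
  have coords: "length (map \<phi> us) = CARD('d) \<and> set (map \<phi> us) \<subseteq> W"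
    if "us \<in> tangent_lists A CARD('d) p" for us
    using that unfolding tangent_lists_def W_def T_def by auto
  have "g (map L (map \<phi> es)) \<noteq> 0"
    using alternating_top_degree_nonzero[OF _
        lin[OF f(1)[folded T_def]] anti[OF f(2)] lin[OF g(1)[folded T_def]] anti[OF g(2)] W
        conjunct1[OF coords[OF es(1)]] conjunct2[OF coords[OF es(1)]] _
        conjunct1[OF coords[OF vs(1)]] conjunct2[OF coords[OF vs(1)]]]
      es vs L_map by simp
  then show ?thesis using L_map[OF es(1)] by simp
qed

section \<open>The sign change along a half circle\<close>

lemma not_almost_cosymplectic_sphere:
  fixes A :: "('a, 'd::finite) chart set"
  assumes X: "smooth_atlas X A" "topspace X \<noteq> {}" and d: "CARD('d) = 4 * n + 1"
  shows "\<not> almost_cosymplectic_sphere X A q \<eta> \<Omega>"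
proof
  assume sph: "almost_cosymplectic_sphere X A q \<eta> \<Omega>"
  obtain p where p: "p \<in> topspace X" using X by blast
  \<comment> \<open>A great circle in the plane of the first two coordinates; it exists in every
    sphere with \<open>q \<ge> 1\<close>, so one argument serves circles and higher spheres. The
    values \<open>l 0\<close> and \<open>l pi\<close> are antipodal.\<close>
  define l :: "real \<Rightarrow> nat \<Rightarrow> real"
    where "l t i = (if i = 1 then cos t else if i = 2 then sin t else 0)" for t i
  define V where "V t = wedge 1 (2 * (2 * n)) (form_lincomb q (l t) \<eta>)
    (wedge_power 2 (form_lincomb q (l t) \<Omega>) (2 * n)) p" for t
  have q: "q \<ge> 1" using sph unfolding almost_cosymplectic_sphere_def by blast
  have sphere: "l t \<in> std_sphere q" for t
  proof -
    have "(\<Sum>i=1..q+1. (l t i)\<^sup>2) = (\<Sum>i\<in>{1,2}. (l t i)\<^sup>2)"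
      using q by (intro sum.mono_neutral_right) (auto simp: l_def)
    then show ?thesis using q unfolding std_sphere_def by (auto simp: l_def)
  qed
  have ac: "almost_cosymplectic X A (form_lincomb q (l t) \<eta>) (form_lincomb q (l t) \<Omega>)" for t
    using sph sphere unfolding almost_cosymplectic_sphere_def by blast
  have lin: "multilinear_on tvec_lincomb (tangent_space A p) k (\<omega> p)" if "diff_form X A k \<omega>" for k \<omega>
    using that p unfolding diff_form_def alternating_at_def multilinear_on_def tangent_lists_def
    by blast
  \<comment> \<open>Written with the 1 first to match the degree \<open>k + l\<close> of a wedge
    product.\<close>
  have deg: "CARD('d) = 1 + 2 * (2 * n)" using d by simp
  have Vlin: "multilinear_on tvec_lincomb (tangent_space A p) CARD('d) (V t)" for t
    unfolding V_def deg using ac[of t] unfolding almost_cosymplectic_def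
    by (intro multilinear_on_wedge multilinear_on_wedge_power lin) blast+
  have Vanti: "antisymmetric_list CARD('d) (V t)" for t
    unfolding V_def deg by (rule antisymmetric_list_wedge)
  have Vnz: "\<exists>vs\<in>tangent_lists A CARD('d) p. V t vs \<noteq> 0" for t
  proof -
    \<comment> \<open>The exponent hidden in the existential is forced by the dimension to be the
      \<open>2 * n\<close> used in \<open>V\<close>.\<close>
    obtain m where "CARD('d) = 2 * m + 1" and nz: "nowhere_zero X A (2 * m + 1)
        (wedge 1 (2 * m) (form_lincomb q (l t) \<eta>) (wedge_power 2 (form_lincomb q (l t) \<Omega>) m))"
      using ac[of t] unfolding almost_cosymplectic_def by blast
    then have m: "m = 2 * n" using d by simp
    then show ?thesis using nz p deg unfolding nowhere_zero_def V_def m by simp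
  qed
  \<comment> \<open>The arguments are chosen at parameter 0 and then kept for all t, which turns
    nonvanishing forms into one nonvanishing real function.\<close>
  obtain es where es: "es \<in> tangent_lists A CARD('d) p" "V 0 es \<noteq> 0" using Vnz by blast
  have nz: "V t es \<noteq> 0" for t
    using Vnz[of t] tangent_top_degree_nonzero[OF X(1) p Vlin Vanti Vlin Vanti es] by blast
  have cont_form: "continuous_on U (\<lambda>t. form_lincomb q (l t) \<omega> p vs)"
    for U vs and \<omega> :: "nat \<Rightarrow> ('a, 'd) dform"
  proof -
    have "continuous_on U (\<lambda>t. l t i)" for i
      unfolding l_def by (cases "i = 1"; cases "i = 2") (auto intro!: continuous_intros)
    then show ?thesis unfolding form_lincomb_def by (intro continuous_intros)
  qed
  have cont: "continuous_on {0..pi} (\<lambda>t. V t es)"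
    unfolding V_def by (intro continuous_on_wedge continuous_on_wedge_power cont_form)
  have "l pi i = - l 0 i" for i by (simp add: l_def)
  then have neg: "form_lincomb q (l pi) \<omega> = (\<lambda>p vs. (-1) * form_lincomb q (l 0) \<omega> p vs)"
    for \<omega> :: "nat \<Rightarrow> ('a, 'd) dform"
    unfolding form_lincomb_def by (simp add: sum_negf)
  \<comment> \<open>Here dimension 4n+1 enters: the 2n factors \<Omega> contribute
    \<open>(-1) ^ (2 * n) = 1\<close>, so only the sign from \<eta> survives.\<close>
  have "V pi es = - V 0 es"
    unfolding V_def neg wedge_power_scale wedge_scale by simp
  \<comment> \<open>The two cases are the two possible directions of the sign change, for
    \<open>IVT'\<close> and \<open>IVT2'\<close> respectively.\<close>
  then consider "V 0 es \<le> 0" "0 \<le> V pi es" | "V pi es \<le> 0" "0 \<le> V 0 es" by linarith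
  then show False
    using IVT'[of "\<lambda>t. V t es" 0 0 pi] IVT2'[of "\<lambda>t. V t es" pi 0 0] cont nz by cases auto
qed

theorem theorem2p6:
  fixes X :: "'a topology" and A :: "('a, 'd::finite) chart set" and n :: nat
  assumes "smooth_manifold X A" and "topspace X \<noteq> {}" and "CARD('d) = 4 * n + 1"
  shows "(\<nexists>\<eta> \<Omega>. almost_cosymplectic_circle X A \<eta> \<Omega>) \<and>
         (\<forall>p\<ge>2. \<nexists>\<eta> \<Omega>. almost_cosymplectic_sphere X A p \<eta> \<Omega>)"
  using not_almost_cosymplectic_sphere[OF _ assms(2,3)] assms(1)
  unfolding smooth_manifold_def almost_cosymplectic_circle_def by blast

end
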